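(* Let $f \in \mathcal{C}_{\mathcal{AP}}$, with Taylor expansion $f(z)=z+\sum_{n\ge 2}a_nz^n$, and let $\Gamma_1,\Gamma_2$ be its first two inverse logarithmic coefficients. Then \[ -\frac{3\sqrt{6}}{4\sqrt{55}} \le |\Gamma_2|-|\Gamma_1| \le \frac{1}{8}. \] These bounds are sharp, i.e. for each of the two inequalities there is a function $f\in\mathcal{C}_{\mathcal{AP}}$ for which equality holds.
   Context: Let $\mathbb{D}=\{z\in\mathbb{C}:|z|<1\}$ and let $\mathcal{A}$ be the class of analytic functions $f$ in $\mathbb{D}$ normalized by $f(0)=0$, $f'(0)=1$, so that $f(z)=z+\sum_{n=2}^\infty a_nz^n$. For analytic $f,g$ in $\mathbb{D}$, $f$ is subordinate to $g$, written $f\prec g$, if there is a Schwarz function $\omega$ (analytic in $\mathbb{D}$, $\omega(0)=0$, $|\omega(z)|<1$ for $z\in\mathbb{D}$) with $f(z)=g(\omega(z))$ for all $z\in\mathbb{D}$. The apple-like convex class $\mathcal{C}_{\mathcal{AP}}$ consists of all $f\in\mathcal{A}$ with $1+\frac{zf''(z)}{f'(z)}\prec \psi_{\mathcal{AP}}(z)$ in $\mathbb{D}$, where $\psi_{\mathcal{AP}}(z)=e^{z}\sqrt{1+z}$ (branch of the square root with $\sqrt{1}=1$). It is a subclass of the class of normalized convex univalent functions. The inverse logarithmic coefficients $\Gamma_n$ of a univalent $f\in\mathcal{A}$ are defined by $\log\frac{f^{-1}(w)}{w}=2\sum_{n=1}^\infty\Gamma_nw^n$, $|w|<\frac14$. The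 first two are \[ \Gamma_1=-\tfrac12a_2,\qquad \Gamma_2=-\tfrac12a_3+\tfrac34a_2^2. \] *)

theory Defs
  imports "HOL-Complex_Analysis.Complex_Analysis"
begin

text \<open>Functions on the open unit disc are total functions on the complex numbers; their values
  outside \<^term>\<open>ball 0 1 :: complex set\<close> never matter.\<close>

definition normalized_analytic :: "(complex \<Rightarrow> complex) set" where
  "normalized_analytic = {f. f holomorphic_on ball 0 1 \<and> f 0 = 0 \<and> deriv f 0 = 1}"

definition schwarz_function :: "(complex \<Rightarrow> complex) \<Rightarrow> bool" where
  "schwarz_function \<omega> \<longleftrightarrow>
     \<omega> holomorphic_on ball 0 1 \<and> \<omega> 0 = 0 \<and> (\<forall>z\<in>ball 0 1. cmod (\<omega> z) < 1)"

definition subordinate :: "(complex \<Rightarrow> complex) \<Rightarrow> (complex \<Rightarrow> complex) \<Rightarrow> bool" where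
  "subordinate f g \<longleftrightarrow>
     f holomorphic_on ball 0 1 \<and> g holomorphic_on ball 0 1 \<and>
     (\<exists>\<omega>. schwarz_function \<omega> \<and> (\<forall>z\<in>ball 0 1. f z = g (\<omega> z)))"

text \<open>For \<open>|z| < 1\<close> the number \<open>1 + z\<close> has positive real part, where \<^const>\<open>csqrt\<close> is the
  analytic branch of the square root with value 1 at 1.\<close>

definition psi_AP :: "complex \<Rightarrow> complex" where
  "psi_AP z = exp z * csqrt (1 + z)"

text \<open>No separate clause \<open>f' z \<noteq> 0\<close> is needed: since \<open>f' 0 = 1\<close>, at a zero of \<open>f'\<close> in the disc
  the quotient below would be unbounded, contradicting the analyticity that is part of
  subordination, whatever value division by zero assigns at the zero itself.\<close>

definition C_AP :: "(complex \<Rightarrow> complex) set" where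
  "C_AP = {f \<in> normalized_analytic.
             subordinate (\<lambda>z. 1 + z * deriv (deriv f) z / deriv f z) psi_AP}"

text \<open>For univalent normalized \<open>f\<close>, the function \<open>w \<mapsto> f\<inverse>(w)/w\<close> (with its limit 1 at \<open>w = 0\<close>)
  is analytic near 0, so the principal logarithm gives, near 0, the analytic branch vanishing
  at 0. The coefficients \<open>\<Gamma>\<^sub>n\<close> in \<open>log (f\<inverse>(w)/w) = 2 \<Sum> \<Gamma>\<^sub>n w\<^sup>n\<close> are thus half of the Taylor
  coefficients of the function below at 0.\<close>

definition log_inverse_quotient :: "(complex \<Rightarrow> complex) \<Rightarrow> complex \<Rightarrow> complex" where
  "log_inverse_quotient f w = Ln (if w = 0 then 1 else inv_into (ball 0 1) f w / w)"

definition inverse_log_coeff :: "(complex \<Rightarrow> complex) \<Rightarrow> nat \<Rightarrow> complex" where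
  "inverse_log_coeff f n = fps_nth (fps_expansion (log_inverse_quotient f) 0) n / 2"

end

theory Submission
  imports Defs
begin

text \<open>
  A member \<open>f\<close> of the class satisfies \<open>1 + z f''(z) / f'(z) = \<psi>(\<omega>(z))\<close> for a Schwarz function
  \<open>\<omega>(z) = c\<^sub>1 z + c\<^sub>2 z\<^sup>2 + \<dots>\<close>, where \<open>\<psi>(z) = 1 + 3/2 z + 7/8 z\<^sup>2 + \<dots>\<close>. Comparing coefficients
  expresses \<open>a\<^sub>2, a\<^sub>3\<close>, and with them the inverse logarithmic coefficients, through \<open>c\<^sub>1, c\<^sub>2\<close>:
  \<open>\<Gamma>\<^sub>1 = - 3/8 c\<^sub>1\<close> and \<open>\<Gamma>\<^sub>2 = 31/192 c\<^sub>1\<^sup>2 - c\<^sub>2/8\<close> (lemma \<open>C_AP_inverse_log_coeffs\<close>).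

  The Schwarz--Pick inequality \<open>|c\<^sub>2| \<le> 1 - |c\<^sub>1|\<^sup>2\<close> (lemma \<open>schwarz_function_coeff_bound\<close>) then turns
  the theorem into an optimisation over \<open>x = |c\<^sub>1| \<in> [0, 1]\<close>. The difference \<open>|\<Gamma>\<^sub>2| - |\<Gamma>\<^sub>1|\<close> is at
  most \<open>1/8 + 7/192 x\<^sup>2 - 3/8 x\<close>, which is largest at \<open>x = 0\<close>. It is at least \<open>- 3/8 x\<close>, and also at
  least \<open>(55 x\<^sup>2 - 24)/192 - 3/8 x\<close>; the two bounds cross at \<open>x\<^sup>2 = 24/55\<close>, to the left of
  which the first decreases and to the right of which the second increases. Hence the extremal
  Schwarz functions are \<open>z\<^sup>2\<close> and \<open>z (z + c)/(1 + c z)\<close> with \<open>c\<^sup>2 = 24/55\<close>, and every Schwarz function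
  comes from a member of the class because \<open>f'\<close> is recovered as the exponential of a primitive
  of \<open>(\<psi> \<circ> \<omega> - 1)/z\<close> (lemma \<open>ode_solution_in_C_AP\<close>).

  The coefficients \<open>\<Gamma>\<^sub>n\<close> are defined through a set-theoretic inverse of \<open>f\<close> on the whole disc, so one
  has to know that near 0 this inverse is the local analytic branch through 0. It suffices that
  \<open>f\<close> takes small values only near 0. This follows from starlikeness, since
  \<open>Re (z f'/f) > 0\<close> makes \<open>|f|\<close> increase along radii; and starlikeness follows from
  \<open>Re (1 + z f''/f') = Re \<psi>(\<omega>(z)) > 0\<close> by the classical fact that convex functions are starlike,
  proved here by looking at a point of least modulus where \<open>f/(z f')\<close> leaves the right
  half-plane.
\<close>

section \<open>The function \<open>\<psi>\<close> on the unit disc\<close>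

lemma psi_AP_holomorphic: "psi_AP holomorphic_on ball 0 1"
proof -
  have "1 + z \<notin> \<real>\<^sub>\<le>\<^sub>0" if "cmod z < 1" for z
    using that abs_Re_le_cmod[of z] by (auto simp: complex_nonpos_Reals_iff)
  then show ?thesis
    unfolding psi_AP_def[abs_def] by (intro holomorphic_intros) auto
qed

text \<open>For \<open>v \<le> 1\<close> the bound \<open>sin v \<le> v\<close> is good enough, for \<open>v > 1\<close> the bound \<open>sin v \<le> 1\<close>;
  both work because \<open>\<pi> > 3\<close>.\<close>
lemma sin_less_quarter_plus:
  fixes v :: real
  assumes "0 < v"
  shows "sin v < pi / 4 + v / 4"
proof (cases "v \<le> 1")
  case True
  then show ?thesis
    using sin_x_le_x[of v] assms pi_gt3 by linarith
next
  case False
  then show ?thesis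
    using sin_le_one[of v] pi_gt3 by linarith
qed

text \<open>The argument of \<open>\<psi>(z)\<close> is \<open>Im z + \<alpha>/2\<close> with \<open>\<alpha> = Arg (1 + z)\<close>. In polar coordinates
  around \<open>-1\<close> the unit disc is \<open>r < 2 cos \<alpha>\<close>, hence \<open>|Im z| \<le> sin (2|\<alpha>|)\<close>, and
  \<open>sin (2|\<alpha>|) + |\<alpha>|/2 < \<pi>/2\<close> is the preceding inequality at \<open>v = \<pi> - 2|\<alpha>|\<close>.\<close>
lemma psi_AP_Re_pos:
  assumes "cmod z < 1"
  shows "0 < Re (psi_AP z)"
proof -
  define r where "r = cmod (1 + z)"
  define a where "a = Arg (1 + z)"
  have Re1: "0 < Re (1 + z)"
    using assms abs_Re_le_cmod[of z] by auto
  then have nz: "1 + z \<noteq> 0"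
    by (metis less_irrefl zero_complex.sel(1))
  have polar: "1 + z = of_real r * exp (\<i> * of_real a)"
    using Arg_eq[OF nz] by (simp add: r_def a_def)
  have a: "\<bar>a\<bar> < pi / 2"
    unfolding a_def Arg_Re_pos using Re1 by blast
  have r0: "0 < r"
    using nz by (simp add: r_def)
  have Rez: "Re z = r * cos a - 1" and Imz: "Im z = r * sin a"
    using arg_cong[OF polar, of Re] arg_cong[OF polar, of Im]
    by (simp_all add: exp_Euler[symmetric] Re_exp Im_exp)
  have "(Re z)\<^sup>2 + (Im z)\<^sup>2 < 1"
    using assms by (simp add: cmod_power2[symmetric] power_less_one_iff)
  also have "(Re z)\<^sup>2 + (Im z)\<^sup>2 = r\<^sup>2 * ((sin a)\<^sup>2 + (cos a)\<^sup>2) - 2 * r * cos a + 1"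
    unfolding Rez Imz by algebra
  finally have "r * (r - 2 * cos a) < 0"
    by (simp add: power2_eq_square algebra_simps)
  then have r_less: "r < 2 * cos a"
    using r0 by (simp add: mult_less_0_iff)
  have "\<bar>Im z\<bar> \<le> sin (2 * \<bar>a\<bar>)"
  proof -
    have "\<bar>Im z\<bar> = r * \<bar>sin a\<bar>"
      using r0 by (simp add: Imz abs_mult)
    also have "\<bar>sin a\<bar> = sin \<bar>a\<bar>"
      using a sin_ge_zero[of "\<bar>a\<bar>"] by (cases "a \<ge> 0") (auto simp: abs_if)
    also have "r * sin \<bar>a\<bar> \<le> 2 * cos a * sin \<bar>a\<bar>"
      using r_less a sin_ge_zero[of "\<bar>a\<bar>"] by (intro mult_right_mono) auto
    also have "\<dots> = sin (2 * \<bar>a\<bar>)"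
      by (simp add: sin_double)
    finally show ?thesis .
  qed
  moreover have "sin (2 * \<bar>a\<bar>) < pi / 2 - \<bar>a\<bar> / 2"
    using sin_less_quarter_plus[of "pi - 2 * \<bar>a\<bar>"] a by (simp add: field_simps)
  ultimately have *: "\<bar>Im z + a / 2\<bar> < pi / 2"
    by linarith
  have "psi_AP z = exp (z + Ln (1 + z) / 2)"
    using nz by (simp add: psi_AP_def csqrt_exp_Ln exp_add)
  moreover have "Im (z + Ln (1 + z) / 2) = Im z + a / 2"
    using nz by (simp add: a_def Arg_def)
  ultimately have "Re (psi_AP z) = exp (Re (z + Ln (1 + z) / 2)) * cos (Im z + a / 2)"
    by (simp add: Re_exp)
  moreover have "0 < cos (Im z + a / 2)"
    using * unfolding abs_less_iff by (intro cos_gt_zero_pi) linarith+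
  ultimately show ?thesis by simp
qed

lemma psi_AP_expansion:
  obtains \<Psi> where "psi_AP has_fps_expansion \<Psi>"
    "fps_nth \<Psi> 0 = 1" "fps_nth \<Psi> 1 = 3/2" "fps_nth \<Psi> 2 = 7/8"
proof
  have "(\<lambda>z::complex. exp z * (1 + z) powr (1/2)) has_fps_expansion fps_exp 1 * fps_binomial (1/2)"
    by (intro has_fps_expansion_mult has_fps_expansion_exp1 has_fps_expansion_binomial_complex)
  moreover have "(\<lambda>z. exp z * (1 + z) powr (1/2)) = psi_AP"
  proof
    fix z :: complex
    show "exp z * (1 + z) powr (1/2) = psi_AP z"
      by (cases "1 + z = 0") (simp_all add: psi_AP_def csqrt_conv_powr)
  qed
  ultimately show "psi_AP has_fps_expansion fps_exp 1 * fps_binomial (1/2)" by simp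
qed (simp_all add: fps_mult_nth numeral_2_eq_2 gbinomial_prod_rev)

section \<open>Convex functions are starlike\<close>

text \<open>A Miller--Mocanu argument. Let \<open>w\<close> be a point of least modulus with \<open>Re q(w) \<le> 0\<close>. Then
  \<open>Re q(w) = 0\<close>, and \<open>Re q \<ge> 0\<close> on the disc of radius \<open>|w|\<close>. Minimality of \<open>Re q\<close> at \<open>w\<close> along the circle
  forces \<open>w q'(w)\<close> to be real, and minimality along the radius forces \<open>w q'(w) \<le> 0\<close>. The
  imaginary part of the equation then reads \<open>Re P(w) \<cdot> Im q(w) = 0\<close>, so \<open>q(w) = 0\<close>, and the
  real part becomes \<open>w q'(w) = 1\<close>, a contradiction.\<close>
lemma pos_Re_of_differential_equation:
  fixes q P :: "complex \<Rightarrow> complex"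
  assumes q: "q holomorphic_on ball 0 1" and q0: "0 < Re (q 0)"
    and eq: "\<And>z. z \<in> ball 0 1 \<Longrightarrow> P z * q z + z * deriv q z = 1"
    and P: "\<And>z. z \<in> ball 0 1 \<Longrightarrow> 0 < Re (P z)"
    and z: "z \<in> ball 0 1"
  shows "0 < Re (q z)"
proof (rule ccontr)
  assume neg: "\<not> 0 < Re (q z)"
  define S where "S = {w \<in> cball 0 (cmod z). Re (q w) \<le> 0}"
  have cball: "cball 0 (cmod w) \<subseteq> ball 0 1" if "w \<in> ball 0 1" for w :: complex
    using that by auto
  have cont: "continuous_on (ball 0 1) (\<lambda>w. Re (q w))"
    by (intro continuous_intros holomorphic_on_imp_continuous_on q)
  have "closed S"
    unfolding S_def
    by (intro continuous_on_closed_Collect_le continuous_on_subset[OF cont cball[OF z]]) auto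
  then have "compact S"
    by (rule compact_eq_bounded_closed[THEN iffD2, OF conjI, rotated])
      (auto simp: S_def intro: bounded_subset[OF bounded_cball[of 0 "cmod z"]])
  moreover have "z \<in> S"
    using neg by (simp add: S_def)
  ultimately obtain w where w: "w \<in> S" and w_min: "\<And>u. u \<in> S \<Longrightarrow> cmod w \<le> cmod u"
    using continuous_attains_inf[of S norm] continuous_on_norm_id by blast
  have wD: "w \<in> ball 0 1" and Re_w: "Re (q w) \<le> 0" and wz: "cmod w \<le> cmod z"
    using w z by (auto simp: S_def)
  have w0: "w \<noteq> 0"
    using q0 Re_w by auto
  have inside: "0 < Re (q u)" if "cmod u < cmod w" for u
    using w_min[of u] that wz by (force simp: S_def)
  have bdry: "0 \<le> Re (q u)" if "cmod u \<le> cmod w" for u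
  proof (rule continuous_ge_on_closure[of "ball 0 (cmod w)" "\<lambda>u. Re (q u)"])
    show "continuous_on (closure (ball 0 (cmod w))) (\<lambda>u. Re (q u))"
      using w0 by (simp add: continuous_on_subset[OF cont cball[OF wD]])
  qed (use w0 that inside in \<open>auto intro: less_imp_le\<close>)
  have Re_w0: "Re (q w) = 0"
    using Re_w bdry[of w] by simp
  have dq: "(q has_field_derivative deriv q u) (at u)" if "u \<in> ball 0 1" for u
    using holomorphic_derivI[OF q _ that] by simp
  \<comment> \<open>the derivative of \<open>Re q\<close> along the circle through \<open>w\<close>\<close>
  have "Re (deriv q w * (\<i> * w)) = 0"
  proof (rule DERIV_local_min[where d = 1 and x = "0::real"])
    have "((\<lambda>t. w * exp (\<i> * of_real t)) has_vector_derivative \<i> * w) (at 0)"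
      by (rule has_vector_derivative_real_field)
        (auto intro!: derivative_eq_intros)
    then have "(q \<circ> (\<lambda>t. w * exp (\<i> * of_real t)) has_vector_derivative \<i> * w * deriv q w) (at 0)"
      by (rule field_vector_diff_chain_at) (use dq[OF wD] in simp)
    from has_field_derivative_Re[OF this]
    show "((\<lambda>t. Re (q (w * exp (\<i> * of_real t)))) has_real_derivative Re (deriv q w * (\<i> * w))) (at 0)"
      by (simp add: o_def mult_ac)
  qed (use bdry Re_w0 in \<open>auto simp: norm_mult\<close>)
  then have Im0: "Im (w * deriv q w) = 0"
    by (simp add: algebra_simps)
  \<comment> \<open>the derivative of \<open>Re q\<close> along the radius through \<open>w\<close>\<close>
  have Re_le: "Re (w * deriv q w) \<le> 0"
  proof (rule ccontr)
    assume "\<not> Re (w * deriv q w) \<le> 0"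
    moreover have "((\<lambda>t. Re (q (of_real t * w))) has_real_derivative Re (w * deriv q w)) (at 1)"
    proof -
      have "((\<lambda>t. of_real t * w) has_vector_derivative w) (at 1)"
        by (rule has_vector_derivative_real_field)
          (auto intro!: derivative_eq_intros)
      then have "(q \<circ> (\<lambda>t. of_real t * w) has_vector_derivative w * deriv q w) (at 1)"
        by (rule field_vector_diff_chain_at) (use dq[OF wD] in simp)
      from has_field_derivative_Re[OF this] show ?thesis
        by (simp add: o_def)
    qed
    ultimately obtain d where d: "d > 0"
      "\<And>h. 0 < h \<Longrightarrow> h < d \<Longrightarrow> Re (q (of_real (1 - h) * w)) < Re (q (of_real 1 * w))"
      using DERIV_pos_inc_left[of "\<lambda>t. Re (q (of_real t * w))" _ 1] by force
    define h where "h = min (d/2) (1/2)"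
    have h: "0 < h" "h < d" "h < 1"
      using d(1) by (auto simp: h_def)
    have "Re (q (of_real (1 - h) * w)) < 0"
      using d(2)[OF h(1,2)] Re_w0 by simp
    moreover have "cmod (of_real (1 - h) * w) < cmod w"
      using h w0 by (simp add: norm_mult del: of_real_diff)
    ultimately show False
      using inside by fastforce
  qed
  have "Im (P w * q w) = 0"
    using arg_cong[OF eq[OF wD], of Im] Im0 by simp
  then have "Im (q w) = 0"
    using P[OF wD] Re_w0 by simp
  then have "q w = 0"
    using Re_w0 by (simp add: complex_eq_iff)
  then show False
    using arg_cong[OF eq[OF wD], of Re] Re_le by simp
qed

text \<open>The quotient \<open>q = f/(z f')\<close> is, unlike its reciprocal, analytic in the whole disc before
  anything is known about the zeros of \<open>f\<close>, and \<open>f = z f' q\<close> differentiates to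
  \<open>(1 + z f''/f') q + z q' = 1\<close>.\<close>
lemma convex_imp_starlike:
  assumes f: "f holomorphic_on ball 0 1" and f0: "f 0 = 0"
    and nz: "\<And>z. z \<in> ball 0 1 \<Longrightarrow> deriv f z \<noteq> 0"
    and conv: "\<And>z. z \<in> ball 0 1 \<Longrightarrow> 0 < Re (1 + z * deriv (deriv f) z / deriv f z)"
    and z: "z \<in> ball 0 1" "z \<noteq> 0"
  shows "0 < Re (f z / (z * deriv f z))"
proof -
  obtain k where k: "k holomorphic_on ball 0 1" and fk: "\<And>z. cmod z < 1 \<Longrightarrow> f z = z * k z"
    and k0: "deriv f 0 = k 0"
    using Schwarz3[OF f f0] by blast
  define q where "q z = k z / deriv f z" for z
  have f': "deriv f holomorphic_on ball 0 1"
    using f by (intro holomorphic_deriv) auto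
  have q: "q holomorphic_on ball 0 1"
    unfolding q_def[abs_def] by (rule holomorphic_on_divide[OF k f' nz])
  have "(1 + u * deriv (deriv f) u / deriv f u) * q u + u * deriv q u = 1"
    if u: "u \<in> ball 0 1" for u
  proof -
    have dk: "(k has_field_derivative deriv k u) (at u)"
      and df: "(f has_field_derivative deriv f u) (at u)"
      and ddf: "(deriv f has_field_derivative deriv (deriv f) u) (at u)"
      using holomorphic_derivI[OF k _ u] holomorphic_derivI[OF f _ u] holomorphic_derivI[OF f' _ u]
      by auto
    have "(f has_field_derivative k u + u * deriv k u) (at u)"
      by (rule has_field_derivative_transform_within_open[of "\<lambda>u. u * k u" _ _ "ball 0 1"])
        (use u fk in \<open>auto intro!: derivative_eq_intros dk\<close>)
    then have 1: "deriv f u = k u + u * deriv k u"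
      using df DERIV_unique by blast
    have "(q has_field_derivative (deriv k u * deriv f u - k u * deriv (deriv f) u) / (deriv f u)\<^sup>2) (at u)"
      unfolding q_def[abs_def] power2_eq_square
      by (intro DERIV_divide dk ddf nz[OF u])
    then have 2: "deriv q u = (deriv k u * deriv f u - k u * deriv (deriv f) u) / (deriv f u)\<^sup>2"
      by (rule DERIV_imp_deriv)
    have "(1 + u * deriv (deriv f) u / deriv f u) * q u + u * deriv q u
        = (k u + u * deriv k u) / deriv f u"
      unfolding 2 q_def using nz[OF u] by (simp add: field_simps power2_eq_square)
    then show ?thesis
      unfolding 1[symmetric] using nz[OF u] by simp
  qed
  moreover have "0 < Re (q 0)"
    using nz[of 0] by (simp add: q_def k0[symmetric])
  ultimately have "0 < Re (q z)"
    by (intro pos_Re_of_differential_equation[OF q _ _ conv z(1)]) assumption+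
  also have "q z = f z / (z * deriv f z)"
    using z fk by (simp add: q_def)
  finally show ?thesis .
qed

text \<open>With \<open>g(s) = f(s z)\<close> the derivative of \<open>|g|\<^sup>2\<close> is \<open>2 Re (g \<cdot> cnj g')\<close>, which has the sign of
  \<open>Re (g/g')\<close>.\<close>
lemma starlike_imp_norm_mono_radial:
  assumes f: "f holomorphic_on ball 0 1" and f0: "f 0 = 0"
    and star: "\<And>z. z \<in> ball 0 1 \<Longrightarrow> z \<noteq> 0 \<Longrightarrow> 0 < Re (f z / (z * deriv f z))"
    and z: "z \<in> ball 0 1" and t: "0 \<le> t" "t \<le> 1"
  shows "cmod (f (of_real t * z)) \<le> cmod (f z)"
proof -
  define g where "g s = f (of_real s * z)" for s :: real
  define g' where "g' s = z * deriv f (of_real s * z)" for s :: real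
  have "(Re (g t))\<^sup>2 + (Im (g t))\<^sup>2 \<le> (Re (g 1))\<^sup>2 + (Im (g 1))\<^sup>2"
  proof (rule DERIV_nonneg_imp_nondecreasing[OF t(2)])
    fix s :: real
    assume s: "t \<le> s" "s \<le> 1"
    have sz: "of_real s * z \<in> ball 0 1"
      using s t z mult_le_one[of s "cmod z"] mult_left_le_one_le[of "cmod z" s]
      by (auto simp: norm_mult)
    have "((\<lambda>s. of_real s * z) has_vector_derivative z) (at s)"
      by (rule has_vector_derivative_real_field)
        (auto intro!: derivative_eq_intros)
    then have "(f \<circ> (\<lambda>s. of_real s * z) has_vector_derivative z * deriv f (of_real s * z)) (at s)"
      by (rule field_vector_diff_chain_at) (use holomorphic_derivI[OF f _ sz] in simp)
    then have vd: "(g has_vector_derivative g' s) (at s)"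
      by (simp add: o_def g_def[abs_def] g'_def)
    have "((\<lambda>s. (Re (g s))\<^sup>2 + (Im (g s))\<^sup>2) has_real_derivative
        2 * (Re (g s) * Re (g' s) + Im (g s) * Im (g' s))) (at s)"
      using DERIV_add[OF DERIV_power[OF has_field_derivative_Re[OF vd], of 2]
          DERIV_power[OF has_field_derivative_Im[OF vd], of 2]]
      by (simp add: algebra_simps)
    moreover have "0 \<le> Re (g s) * Re (g' s) + Im (g s) * Im (g' s)"
    proof (cases "of_real s * z = 0")
      case True
      then have "g s = 0"
        unfolding g_def by (simp only: f0)
      then show ?thesis by simp
    next
      case False
      then have "0 < Re (g s / (of_real s * g' s))"
        using star[OF sz] by (simp add: g_def g'_def mult_ac)
      also have "g s / (of_real s * g' s) = g s / g' s / of_real s"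
        by simp
      also have "Re \<dots> = Re (g s / g' s) / s"
        by (rule Re_divide_of_real)
      finally have "0 < Re (g s / g' s)"
        using s t False by (simp add: zero_less_divide_iff)
      then have "0 < (Re (g s) * Re (g' s) + Im (g s) * Im (g' s)) / ((Re (g' s))\<^sup>2 + (Im (g' s))\<^sup>2)"
        by (simp add: Re_divide)
      then show ?thesis
        by (simp add: zero_less_divide_iff) 
           (smt (verit) zero_le_power2)
    qed
    ultimately show "\<exists>y. ((\<lambda>s. (Re (g s))\<^sup>2 + (Im (g s))\<^sup>2) has_real_derivative y) (at s) \<and> 0 \<le> y"
      by (intro exI conjI) (assumption, simp)
  qed
  then show ?thesis
    by (simp add: g_def cmod_def)
qed

text \<open>The threshold is the minimum of \<open>|f|\<close> on the circle of radius \<open>r\<close>: it is positive, and beyond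
  that circle \<open>|f|\<close> only grows.\<close>
lemma starlike_imp_small_values_near_0:
  assumes f: "f holomorphic_on ball 0 1" and f0: "f 0 = 0"
    and star: "\<And>z. z \<in> ball 0 1 \<Longrightarrow> z \<noteq> 0 \<Longrightarrow> 0 < Re (f z / (z * deriv f z))"
    and r: "0 < r" "r < 1"
  obtains e where "0 < e" "\<And>z. z \<in> ball 0 1 \<Longrightarrow> cmod (f z) < e \<Longrightarrow> cmod z < r"
proof -
  have sub: "sphere 0 r \<subseteq> ball (0::complex) 1"
    using r by auto
  have "continuous_on (sphere 0 r) (\<lambda>z. cmod (f z))"
    using continuous_on_subset[OF holomorphic_on_imp_continuous_on[OF f] sub]
    by (intro continuous_intros)
  then obtain w where w: "w \<in> sphere 0 r" and w_min: "\<And>u. u \<in> sphere 0 r \<Longrightarrow> cmod (f w) \<le> cmod (f u)"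
    using continuous_attains_inf[of "sphere 0 r" "\<lambda>z. cmod (f z)"] r by auto
  show ?thesis
  proof
    show "0 < cmod (f w)"
      using star[of w] w r by force
    fix z :: complex
    assume z: "z \<in> ball 0 1" and less: "cmod (f z) < cmod (f w)"
    show "cmod z < r"
    proof (rule ccontr)
      assume "\<not> cmod z < r"
      then have t: "0 \<le> r / cmod z" "r / cmod z \<le> 1" "cmod z \<noteq> 0"
        using r by (auto simp: divide_le_eq)
      have "cmod (f w) \<le> cmod (f (of_real (r / cmod z) * z))"
        using t r by (intro w_min) (auto simp: norm_divide norm_mult)
      also have "\<dots> \<le> cmod (f z)"
        by (rule starlike_imp_norm_mono_radial[OF f f0 star z t(1,2)])
      finally show False
        using less by simp
    qed
  qed
qed


section \<open>The class and its Schwarz functions\<close>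

lemma fps_eq_of_eventually_eq:
  fixes F G :: "complex fps"
  assumes "f has_fps_expansion F" "g has_fps_expansion G" "\<forall>\<^sub>F z in nhds 0. f z = g z"
  shows "F = G"
proof (rule fps_expansion_unique_complex)
  show "f has_fps_expansion G"
    using has_fps_expansion_cong[OF assms(3) refl] assms(2) by blast
qed (rule assms)

lemma schwarz_function_expansion:
  assumes "schwarz_function w"
  shows "w has_fps_expansion fps_expansion w 0" "fps_nth (fps_expansion w 0) 0 = 0"
proof -
  show "w has_fps_expansion fps_expansion w 0"
    by (rule has_fps_expansion_fps_expansion[of "ball 0 1"]) (use assms in \<open>auto simp: schwarz_function_def\<close>)
  show "fps_nth (fps_expansion w 0) 0 = 0"
    using assms by (simp add: fps_expansion_def schwarz_function_def)
qed

lemma psi_AP_schwarz_factor: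
  assumes w: "schwarz_function w"
  obtains h where "h holomorphic_on ball 0 1"
    "\<And>z. z \<in> ball 0 1 \<Longrightarrow> psi_AP (w z) = 1 + z * h z"
proof -
  have "(psi_AP \<circ> w) holomorphic_on ball 0 1"
    by (rule holomorphic_on_compose_gen[OF _ psi_AP_holomorphic])
      (use w in \<open>auto simp: schwarz_function_def\<close>)
  then have "(\<lambda>z. psi_AP (w z) - 1) holomorphic_on ball 0 1"
    by (intro holomorphic_intros) (simp add: o_def)
  moreover have "psi_AP (w 0) - 1 = 0"
    using w by (simp add: schwarz_function_def psi_AP_def)
  ultimately obtain h where "h holomorphic_on ball 0 1"
      "\<And>z. cmod z < 1 \<Longrightarrow> psi_AP (w z) - 1 = z * h z"
    using Schwarz3[of "\<lambda>z. psi_AP (w z) - 1" 1] by blast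
  then show ?thesis
    by (intro that[of h]) (auto simp: algebra_simps)
qed

text \<open>The derivative of \<open>f\<close> has no zeros: writing \<open>\<psi> \<circ> \<omega> = 1 + z h\<close>, the linear equation \<open>f'' = h f'\<close>
  holds near 0, where \<open>f' \<noteq> 0\<close>, hence everywhere by analytic continuation, so \<open>f'\<close> is a constant
  multiple of \<open>exp H\<close> for a primitive \<open>H\<close> of \<open>h\<close>. This also removes the division by \<open>f'\<close> from the
  defining relation.\<close>
lemma C_AP_imp_ode:
  assumes "f \<in> C_AP"
  obtains w where "schwarz_function w"
    "\<And>z. z \<in> ball 0 1 \<Longrightarrow> deriv f z \<noteq> 0"
    "\<And>z. z \<in> ball 0 1 \<Longrightarrow> z * deriv (deriv f) z = (psi_AP (w z) - 1) * deriv f z"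
proof -
  have f: "f holomorphic_on ball 0 1" and f1: "deriv f 0 = 1"
    using assms by (auto simp: C_AP_def normalized_analytic_def)
  obtain w where w: "schwarz_function w"
    and eq: "\<And>z. z \<in> ball 0 1 \<Longrightarrow> 1 + z * deriv (deriv f) z / deriv f z = psi_AP (w z)"
    using assms by (auto simp: C_AP_def subordinate_def)
  obtain h where h: "h holomorphic_on ball 0 1"
    and wh: "\<And>z. z \<in> ball 0 1 \<Longrightarrow> psi_AP (w z) = 1 + z * h z"
    by (rule psi_AP_schwarz_factor[OF w]) (rule that)
  have f': "deriv f holomorphic_on ball 0 1"
    using f by (intro holomorphic_deriv) auto
  have f'': "deriv (deriv f) holomorphic_on ball 0 1"
    using f' by (rule holomorphic_deriv) simp
  define V where "V = {z \<in> ball 0 1. deriv f z \<noteq> 0}"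
  have "V = ball 0 1 \<inter> deriv f -` (- {0})"
    by (auto simp: V_def)
  then have "open V"
    using continuous_open_preimage[OF holomorphic_on_imp_continuous_on[OF f'], of "- {0}"] by auto
  moreover have "0 \<in> V"
    by (simp add: V_def f1)
  ultimately have V: "open (V - {0})" "V - {0} \<noteq> {}"
    using not_open_singleton[of "0::complex"] by (auto simp: subset_singleton_iff)
  have ode: "deriv (deriv f) z = h z * deriv f z" if "z \<in> ball 0 1" for z
  proof (rule analytic_continuation_open[OF V(1) open_ball V(2) connected_ball _ f'' _ _ that])
    show "(\<lambda>z. h z * deriv f z) holomorphic_on ball 0 1"
      by (rule holomorphic_on_mult[OF h f'])
    show "deriv (deriv f) z = h z * deriv f z" if "z \<in> V - {0}" for z
    proof -
      have z: "z \<in> ball 0 1" "deriv f z \<noteq> 0" "z \<noteq> 0"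
        using that by (auto simp: V_def)
      have "z * (deriv (deriv f) z / deriv f z) = z * h z"
        using eq[OF z(1)] wh[OF z(1)] by simp
      then show ?thesis
        using z by (simp add: divide_eq_eq)
    qed
  qed (auto simp: V_def)
  obtain H where H: "\<And>z. z \<in> ball 0 1 \<Longrightarrow> (H has_field_derivative h z) (at z)"
    using holomorphic_convex_primitive'[OF convex_ball open_ball h] by (metis at_within_open open_ball)
  have deriv0: "((\<lambda>z. deriv f z * exp (- H z)) has_field_derivative 0) (at z within ball 0 1)"
    if z: "z \<in> ball 0 1" for z
  proof -
    have "((\<lambda>z. exp (- H z)) has_field_derivative exp (- H z) * - h z) (at z)"
      by (rule DERIV_chain2[OF DERIV_exp DERIV_minus[OF H[OF z]]])
    from DERIV_mult[OF holomorphic_derivI[OF f' open_ball z] this]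
    have "((\<lambda>z. deriv f z * exp (- H z)) has_field_derivative 0) (at z)"
      by (simp add: ode[OF z])
    then show ?thesis
      by (rule has_field_derivative_at_within)
  qed
  have "\<exists>c. \<forall>z\<in>ball 0 1. deriv f z * exp (- H z) = c"
    by (rule has_field_derivative_zero_constant[OF convex_ball]) (rule deriv0)
  then obtain c where c: "\<forall>z\<in>ball 0 1. deriv f z * exp (- H z) = c"
    by blast
  have "c \<noteq> 0"
    using c[rule_format, of 0] f1 by auto
  then have "deriv f z \<noteq> 0" if "z \<in> ball 0 1" for z
    using c[rule_format, OF that] by auto
  moreover have "z * deriv (deriv f) z = (psi_AP (w z) - 1) * deriv f z" if "z \<in> ball 0 1" for z
    using ode[OF that] wh[OF that] by simp
  ultimately show ?thesis
    by (rule that[OF w])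
qed

lemma ode_solution_in_C_AP:
  assumes w: "schwarz_function w"
  obtains f where "f \<in> C_AP"
    "\<And>z. z \<in> ball 0 1 \<Longrightarrow> z * deriv (deriv f) z = (psi_AP (w z) - 1) * deriv f z"
proof -
  obtain h where h: "h holomorphic_on ball 0 1"
    and wh: "\<And>z. z \<in> ball 0 1 \<Longrightarrow> psi_AP (w z) = 1 + z * h z"
    by (rule psi_AP_schwarz_factor[OF w]) (rule that)
  obtain H where H: "\<And>z. z \<in> ball 0 1 \<Longrightarrow> (H has_field_derivative h z) (at z)"
    using holomorphic_convex_primitive'[OF convex_ball open_ball h] by (metis at_within_open open_ball)
  define g where "g z = exp (H z - H 0)" for z
  have dg: "(g has_field_derivative h z * g z) (at z)" if "z \<in> ball 0 1" for z
    unfolding g_def[abs_def] using H[OF that] by (auto intro!: derivative_eq_intros)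
  have g: "g holomorphic_on ball 0 1"
    using dg by (auto simp: holomorphic_on_open intro!: exI)
  obtain F where F: "\<And>z. z \<in> ball 0 1 \<Longrightarrow> (F has_field_derivative g z) (at z)"
    using holomorphic_convex_primitive'[OF convex_ball open_ball g] by (metis at_within_open open_ball)
  define f where "f z = F z - F 0" for z
  have df: "(f has_field_derivative g z) (at z)" if "z \<in> ball 0 1" for z
    unfolding f_def[abs_def] using F[OF that] by (auto intro!: derivative_eq_intros)
  have f: "f holomorphic_on ball 0 1"
    using df by (auto simp: holomorphic_on_open intro!: exI)
  have f': "deriv f z = g z" if "z \<in> ball 0 1" for z
    using df[OF that] by (rule DERIV_imp_deriv)
  have f'': "deriv (deriv f) z = h z * g z" if "z \<in> ball 0 1" for z
  proof (rule DERIV_imp_deriv)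
    show "(deriv f has_field_derivative h z * g z) (at z)"
      by (rule has_field_derivative_transform_within_open[OF dg[OF that] open_ball that])
        (simp add: f')
  qed
  have ode: "z * deriv (deriv f) z = (psi_AP (w z) - 1) * deriv f z" if "z \<in> ball 0 1" for z
    using that by (simp add: f' f'' wh)
  have eq: "1 + z * deriv (deriv f) z / deriv f z = psi_AP (w z)" if "z \<in> ball 0 1" for z
    using that by (simp add: f' f'' wh g_def)
  have "(\<lambda>z. 1 + z * deriv (deriv f) z / deriv f z) holomorphic_on ball 0 1"
  proof (rule holomorphic_transform)
    show "(\<lambda>z. 1 + z * h z) holomorphic_on ball 0 1"
      by (intro holomorphic_intros h)
  qed (simp add: eq wh)
  then have "subordinate (\<lambda>z. 1 + z * deriv (deriv f) z / deriv f z) psi_AP"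
    unfolding subordinate_def using psi_AP_holomorphic w eq by blast
  moreover have "f \<in> normalized_analytic"
    using f f'[of 0] by (simp add: normalized_analytic_def f_def g_def)
  ultimately have "f \<in> C_AP"
    by (simp add: C_AP_def)
  then show ?thesis
    using that ode by blast
qed

lemma C_AP_small_values_near_0:
  assumes "f \<in> C_AP" "0 < r" "r < 1"
  obtains e where "0 < e" "\<And>z. z \<in> ball 0 1 \<Longrightarrow> cmod (f z) < e \<Longrightarrow> cmod z < r"
proof -
  have f: "f holomorphic_on ball 0 1" and f0: "f 0 = 0"
    using assms by (auto simp: C_AP_def normalized_analytic_def)
  obtain w where w: "schwarz_function w" and nz: "\<And>z. z \<in> ball 0 1 \<Longrightarrow> deriv f z \<noteq> 0"
    and ode: "\<And>z. z \<in> ball 0 1 \<Longrightarrow> z * deriv (deriv f) z = (psi_AP (w z) - 1) * deriv f z"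
    by (rule C_AP_imp_ode[OF assms(1)]) (rule that)
  have "0 < Re (1 + z * deriv (deriv f) z / deriv f z)" if z: "z \<in> ball 0 1" for z
  proof -
    have "1 + z * deriv (deriv f) z / deriv f z = psi_AP (w z)"
      using ode[OF z] nz[OF z] by simp
    moreover have "cmod (w z) < 1"
      using w z by (simp add: schwarz_function_def)
    ultimately show ?thesis
      using psi_AP_Re_pos by simp
  qed
  from starlike_imp_small_values_near_0[OF f f0 convex_imp_starlike[OF f f0 nz this] assms(2,3)]
  show ?thesis
    using that by blast
qed

text \<open>Comparing the coefficients of \<open>z\<close> and \<open>z\<^sup>2\<close> in \<open>z f'' = (\<psi> \<circ> \<omega> - 1) f'\<close> gives
  \<open>2 a\<^sub>2 = 3/2 c\<^sub>1\<close> and \<open>6 a\<^sub>3 = 3/2 c\<^sub>1 \<cdot> 2 a\<^sub>2 + (3/2 c\<^sub>2 + 7/8 c\<^sub>1\<^sup>2)\<close>.\<close>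
lemma C_AP_coefficients:
  assumes f: "f holomorphic_on ball 0 1" "f 0 = 0" "deriv f 0 = 1" and w: "schwarz_function w"
    and ode: "\<And>z. z \<in> ball 0 1 \<Longrightarrow> z * deriv (deriv f) z = (psi_AP (w z) - 1) * deriv f z"
  defines "F \<equiv> fps_expansion f 0" and "W \<equiv> fps_expansion w 0"
  shows "fps_nth F 2 = 3/4 * fps_nth W 1"
    and "fps_nth F 3 = 1/4 * fps_nth W 2 + 25/48 * (fps_nth W 1)\<^sup>2"
proof -
  have F: "f has_fps_expansion F"
    unfolding F_def by (rule has_fps_expansion_fps_expansion[of "ball 0 1"]) (use f in auto)
  have F1: "fps_nth F 1 = 1"
    by (simp add: F_def fps_expansion_def f)
  note W = schwarz_function_expansion[OF w, folded W_def]
  obtain \<Psi> where \<Psi>: "psi_AP has_fps_expansion \<Psi>"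
    "fps_nth \<Psi> 0 = 1" "fps_nth \<Psi> 1 = 3/2" "fps_nth \<Psi> 2 = 7/8"
    by (rule psi_AP_expansion)
  define P where "P = fps_compose \<Psi> W"
  have P: "(psi_AP \<circ> w) has_fps_expansion P"
    unfolding P_def by (rule has_fps_expansion_compose[OF \<Psi>(1) W])
  have P_nth: "fps_nth P 0 = 1" "fps_nth P 1 = 3/2 * fps_nth W 1"
    "fps_nth P 2 = 3/2 * fps_nth W 2 + 7/8 * (fps_nth W 1)\<^sup>2"
    using W(2)
    by (simp_all add: P_def fps_compose_nth power2_eq_square fps_mult_nth numeral_2_eq_2
        \<Psi>(2-4)[unfolded numeral_2_eq_2 One_nat_def])
  have "(\<lambda>z. z * deriv (deriv f) z) has_fps_expansion fps_X * fps_deriv (fps_deriv F)"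
    by (intro has_fps_expansion_mult has_fps_expansion_fps_X has_fps_expansion_deriv F)
  moreover have "(\<lambda>z. ((psi_AP \<circ> w) z - 1) * deriv f z) has_fps_expansion (P - 1) * fps_deriv F"
    by (intro has_fps_expansion_mult has_fps_expansion_diff has_fps_expansion_1
        has_fps_expansion_deriv F P)
  moreover have "\<forall>\<^sub>F z in nhds 0. z * deriv (deriv f) z = ((psi_AP \<circ> w) z - 1) * deriv f z"
    by (rule eventually_nhds_in_open[THEN eventually_mono, of "ball 0 1"]) (use ode in auto)
  ultimately have eq: "fps_X * fps_deriv (fps_deriv F) = (P - 1) * fps_deriv F"
    by (rule fps_eq_of_eventually_eq)
  have "2 * fps_nth F 2 = fps_nth P 1"
    using arg_cong[OF eq, of "\<lambda>A. fps_nth A 1"] P_nth F1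
    by (simp add: fps_mult_nth numeral_2_eq_2)
  then show F2: "fps_nth F 2 = 3/4 * fps_nth W 1"
    unfolding P_nth by (simp add: field_simps)
  have "6 * fps_nth F 3 = fps_nth P 1 * (2 * fps_nth F 2) + fps_nth P 2"
    using arg_cong[OF eq, of "\<lambda>A. fps_nth A 2"] P_nth F1
    by (simp add: fps_mult_nth numeral_2_eq_2 numeral_3_eq_3)
  then show "fps_nth F 3 = 1/4 * fps_nth W 2 + 25/48 * (fps_nth W 1)\<^sup>2"
    unfolding F2 P_nth by (simp add: field_simps power2_eq_square)
qed

section \<open>Inverse logarithmic coefficients\<close>

text \<open>The hypothesis \<open>small\<close> makes the chosen inverse agree near 0 with the local analytic inverse,
  so \<open>L(w) = log (f\<inverse>(w)/w)\<close> is analytic at 0. Substituting \<open>w = f(z)\<close> eliminates the inverse: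
  \<open>L\<close> satisfies \<open>f(z) exp (L(f(z))) = z\<close>, and the coefficients of \<open>z\<^sup>2\<close> and \<open>z\<^sup>3\<close> in this identity
  determine the first two coefficients of \<open>L\<close>.\<close>
lemma inverse_log_coeff_eq:
  assumes f: "f holomorphic_on ball 0 1" "f 0 = 0" "deriv f 0 = 1"
    and small: "\<And>r. 0 < r \<Longrightarrow> r < 1 \<Longrightarrow> \<exists>e>0. \<forall>z\<in>ball 0 1. cmod (f z) < e \<longrightarrow> cmod z < r"
  defines "F \<equiv> fps_expansion f 0"
  shows "inverse_log_coeff f 1 = - fps_nth F 2 / 2"
    and "inverse_log_coeff f 2 = - fps_nth F 3 / 2 + 3/4 * (fps_nth F 2)\<^sup>2"
proof -
  obtain r where r: "r > 0" "ball 0 r \<subseteq> ball (0::complex) 1" "inj_on f (ball 0 r)"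
    by (rule has_complex_derivative_locally_injective[OF f(1), of 0]) (use f(3) in auto)
  define s where "s = r / 2"
  have s: "0 < s" "s < 1" "ball 0 s \<subseteq> ball (0::complex) r" "ball 0 s \<subseteq> ball (0::complex) 1"
    using r(1,2) by (auto simp: s_def ball_subset_ball_iff)
  have fs: "f holomorphic_on ball 0 s" and inj: "inj_on f (ball 0 s)"
    using holomorphic_on_subset[OF f(1) s(4)] inj_on_subset[OF r(3) s(3)] .
  obtain g where g: "g holomorphic_on f ` ball 0 s"
    and dg: "\<And>z. z \<in> ball 0 s \<Longrightarrow> deriv f z * deriv g (f z) = 1"
    and gf: "\<And>z. z \<in> ball 0 s \<Longrightarrow> g (f z) = z"
    using holomorphic_has_inverse[OF fs open_ball inj] by blast
  obtain e where e: "e > 0" "\<And>z. z \<in> ball 0 1 \<Longrightarrow> cmod (f z) < e \<Longrightarrow> cmod z < s"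
    using small[OF s(1,2)] by blast
  define B where "B = f ` ball 0 s \<inter> ball 0 e"
  have B: "open B" "0 \<in> B"
    using open_mapping_thm3[OF fs open_ball inj] e(1) s(1) f(2) by (auto simp: B_def image_iff intro!: bexI[of _ 0])
  have inv: "inv_into (ball 0 1) f y = g y" if y: "y \<in> B" for y
  proof -
    define u where "u = inv_into (ball 0 1) f y"
    have "y \<in> f ` ball 0 1"
      using y s(4) by (auto simp: B_def)
    then have u: "u \<in> ball 0 1" "f u = y"
      unfolding u_def by (rule inv_into_into, rule f_inv_into_f)
    then have "u \<in> ball 0 s"
      using e(2)[of u] y by (simp add: B_def)
    then show ?thesis
      using gf[of u] u(2) by (simp add: u_def)
  qed
  have g0: "g 0 = 0" and dg0: "deriv g 0 = 1"
    using gf[of 0] dg[of 0] s(1) f by auto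
  define q where "q y = (if y = 0 then 1 else g y / y)" for y
  have q: "q holomorphic_on B"
    by (rule pole_theorem_open_0[of g B 0])
      (use g B g0 dg0 in \<open>auto simp: q_def B_def intro: holomorphic_on_subset\<close>)
  \<comment> \<open>Values of \<open>q\<close> within distance 1 of \<open>q(0) = 1\<close> avoid the branch cut of the logarithm.\<close>
  define C where "C = B \<inter> q -` ball 1 1"
  have C: "open C" "0 \<in> C" "C \<subseteq> B"
    using continuous_open_preimage[OF holomorphic_on_imp_continuous_on[OF q] B(1), of "ball 1 1"] B
    by (auto simp: C_def q_def)
  define L where "L = log_inverse_quotient f"
  have L_eq: "L y = Ln (q y)" if "y \<in> C" for y
    using that C(3) inv by (auto simp: L_def log_inverse_quotient_def q_def)
  have "(\<lambda>y. Ln (q y)) holomorphic_on C"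
  proof (intro holomorphic_intros holomorphic_on_subset[OF q C(3)])
    show "q y \<notin> \<real>\<^sub>\<le>\<^sub>0" if "y \<in> C" for y
      using that abs_Re_le_cmod[of "1 - q y"]
      by (auto simp: C_def dist_norm complex_nonpos_Reals_iff)
  qed
  then have "L holomorphic_on C"
    by (rule holomorphic_transform) (simp add: L_eq)
  define \<Lambda> where "\<Lambda> = fps_expansion L 0"
  have \<Lambda>: "L has_fps_expansion \<Lambda>"
    unfolding \<Lambda>_def by (rule has_fps_expansion_fps_expansion) fact+
  have \<Lambda>0: "fps_nth \<Lambda> 0 = 0"
    using L_eq[OF C(2)] by (simp add: \<Lambda>_def fps_expansion_def q_def)
  have F: "f has_fps_expansion F"
    unfolding F_def by (rule has_fps_expansion_fps_expansion[of "ball 0 1"]) (use f in auto)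
  have F0: "fps_nth F 0 = 0" and F1: "fps_nth F 1 = 1"
    by (simp_all add: F_def fps_expansion_def f)
  define M where "M = fps_compose \<Lambda> F"
  have M: "(L \<circ> f) has_fps_expansion M"
    unfolding M_def by (rule has_fps_expansion_compose[OF \<Lambda> F F0])
  have M_nth: "fps_nth M 0 = 0" "fps_nth M 1 = fps_nth \<Lambda> 1"
    "fps_nth M 2 = fps_nth \<Lambda> 1 * fps_nth F 2 + fps_nth \<Lambda> 2"
    using \<Lambda>0 F0 F1
    by (simp_all add: M_def fps_compose_nth numeral_2_eq_2 power2_eq_square fps_mult_nth)
  define E where "E = fps_compose (fps_exp 1) M"
  have E: "(exp \<circ> (L \<circ> f)) has_fps_expansion E"
    unfolding E_def by (rule has_fps_expansion_compose[OF has_fps_expansion_exp1 M M_nth(1)])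
  have E_nth: "fps_nth E 0 = 1" "fps_nth E 1 = fps_nth M 1"
    "fps_nth E 2 = fps_nth M 2 + (fps_nth M 1)\<^sup>2 / 2"
    using M_nth(1)
    by (simp_all add: E_def fps_compose_nth numeral_2_eq_2 power2_eq_square fps_mult_nth)
  have "open (ball 0 s \<inter> f -` C)"
    by (rule continuous_open_preimage[OF holomorphic_on_imp_continuous_on[OF fs] open_ball C(1)])
  moreover have "0 \<in> ball 0 s \<inter> f -` C"
    using s(1) C(2) f(2) by simp
  ultimately have "\<forall>\<^sub>F z in nhds 0. z \<in> ball 0 s \<inter> f -` C"
    by (rule eventually_nhds_in_open)
  then have ev: "\<forall>\<^sub>F z in nhds 0. f z * (exp \<circ> (L \<circ> f)) z = z"
  proof eventually_elim
    case (elim z)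
    show ?case
    proof (cases "z = 0")
      case False
      then have "f z \<noteq> 0"
        using gf[of z] g0 elim by auto
      then show ?thesis
        using False elim gf[of z] L_eq[of "f z"] by (simp add: q_def)
    qed (simp add: f)
  qed
  have eq: "F * E = fps_X"
    by (rule fps_eq_of_eventually_eq[OF has_fps_expansion_mult[OF F E] has_fps_expansion_fps_X ev])
  have eq2: "fps_nth \<Lambda> 1 + fps_nth F 2 = 0"
    using arg_cong[OF eq, of "\<lambda>A. fps_nth A 2"] E_nth M_nth F0 F1
    by (simp add: fps_mult_nth numeral_2_eq_2)
  have eq3: "fps_nth M 2 + (fps_nth \<Lambda> 1)\<^sup>2 / 2 + fps_nth F 2 * fps_nth \<Lambda> 1 + fps_nth F 3 = 0"
    using arg_cong[OF eq, of "\<lambda>A. fps_nth A 3"] E_nth M_nth F0 F1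
    by (simp add: fps_mult_nth numeral_2_eq_2 numeral_3_eq_3)
  have L1: "fps_nth \<Lambda> 1 = - fps_nth F 2"
    using eq2 by (simp add: eq_neg_iff_add_eq_0)
  have L2: "fps_nth \<Lambda> 2 = - fps_nth F 3 + 3/2 * (fps_nth F 2)\<^sup>2"
    using eq3 unfolding M_nth L1 by (simp add: power2_eq_square field_simps)
  show "inverse_log_coeff f 1 = - fps_nth F 2 / 2"
    using L1 by (simp add: inverse_log_coeff_def L_def \<Lambda>_def)
  show "inverse_log_coeff f 2 = - fps_nth F 3 / 2 + 3/4 * (fps_nth F 2)\<^sup>2"
    using L2 by (simp add: inverse_log_coeff_def L_def[symmetric] \<Lambda>_def[symmetric])
qed

text \<open>Schwarz--Pick for \<open>h(z) = \<omega>(z)/z\<close> at 0: the Moebius map that sends \<open>h(0)\<close> to 0 reduces it to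
  the Schwarz lemma. If \<open>|h|\<close> reaches 1 inside the disc, the equality case of the Schwarz
  lemma makes \<open>\<omega>\<close> a rotation, whose second coefficient is 0.\<close>
lemma schwarz_function_coeff_bound:
  assumes w: "schwarz_function w"
  defines "W \<equiv> fps_expansion w 0"
  shows "cmod (fps_nth W 2) \<le> 1 - (cmod (fps_nth W 1))\<^sup>2"
proof -
  have holw: "w holomorphic_on ball 0 1" and w0: "w 0 = 0"
    and w1: "\<And>z. cmod z < 1 \<Longrightarrow> cmod (w z) < 1"
    using w by (auto simp: schwarz_function_def)
  note W = schwarz_function_expansion[OF w, folded W_def]
  obtain h where h: "h holomorphic_on ball 0 1" and wh: "\<And>z. cmod z < 1 \<Longrightarrow> w z = z * h z"
    and h0: "deriv w 0 = h 0"
    using Schwarz3[OF holw w0] by blast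
  show ?thesis
  proof (cases "\<forall>z\<in>ball 0 1. cmod (h z) < 1")
    case True
    have H: "h has_fps_expansion fps_expansion h 0"
      by (rule has_fps_expansion_fps_expansion[of "ball 0 1"]) (use h in auto)
    have "(\<lambda>z. z * h z) has_fps_expansion fps_X * fps_expansion h 0"
      by (rule has_fps_expansion_mult[OF has_fps_expansion_fps_X H])
    moreover have "\<forall>\<^sub>F z in nhds 0. w z = z * h z"
      by (rule eventually_nhds_in_open[THEN eventually_mono, of "ball 0 1"]) (use wh in auto)
    ultimately have "W = fps_X * fps_expansion h 0"
      by (rule fps_eq_of_eventually_eq[OF W(1)])
    then have W12: "fps_nth W 1 = h 0" "fps_nth W 2 = deriv h 0"
      by (simp_all add: fps_expansion_def)
    define a where "a = h 0"
    have a: "cmod a < 1"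
      using True by (simp add: a_def)
    define m where "m = Moebius_function 0 a \<circ> h"
    have m: "m holomorphic_on ball 0 1"
      unfolding m_def
      by (rule holomorphic_on_compose_gen[OF h Moebius_function_holomorphic[OF a]]) (use True in auto)
    have nz: "1 - cnj a * a = of_real (1 - (cmod a)\<^sup>2)"
      using complex_norm_square[of a] by (simp add: mult.commute)
    have pos: "0 < 1 - (cmod a)\<^sup>2"
      using a by (simp add: power_less_one_iff)
    have "((\<lambda>z. (h z - a) / (1 - cnj a * h z)) has_field_derivative
        ((deriv h 0 - 0) * (1 - cnj a * h 0) - (h 0 - a) * (0 - cnj a * deriv h 0)) /
        ((1 - cnj a * h 0) * (1 - cnj a * h 0))) (at 0)"
    proof (intro DERIV_divide DERIV_diff DERIV_const DERIV_cmult holomorphic_derivI[OF h open_ball])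
      show "1 - cnj a * h 0 \<noteq> 0"
        using nz pos unfolding a_def[symmetric] by (metis of_real_eq_0_iff less_irrefl)
    qed simp_all
    then have "deriv m 0 = ((deriv h 0 - 0) * (1 - cnj a * h 0) - (h 0 - a) * (0 - cnj a * deriv h 0)) /
        ((1 - cnj a * h 0) * (1 - cnj a * h 0))"
      by (intro DERIV_imp_deriv) (simp add: m_def o_def Moebius_function_simple)
    also have "\<dots> = deriv h 0 / of_real (1 - (cmod a)\<^sup>2)"
      unfolding a_def[symmetric] nz using pos by simp
    finally have "cmod (deriv h 0) / (1 - (cmod a)\<^sup>2) = cmod (deriv m 0)"
      using pos by (simp add: norm_divide del: of_real_diff)
    also have "\<dots> \<le> 1"
    proof (rule Schwarz_Lemma(2)[OF m, of 0])
      show "m 0 = 0"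
        by (simp add: m_def a_def Moebius_function_eq_zero)
      show "cmod (m z) < 1" if "cmod z < 1" for z
        unfolding m_def o_def by (rule Moebius_function_norm_lt_1[OF a]) (use True that in auto)
    qed simp
    finally show ?thesis
      unfolding W12 a_def[symmetric] using pos by simp
  next
    case False
    then obtain z where z: "cmod z < 1" "1 \<le> cmod (h z)"
      by (auto simp: not_less)
    have "(\<exists>z. cmod z < 1 \<and> z \<noteq> 0 \<and> cmod (w z) = cmod z) \<or> cmod (deriv w 0) = 1"
    proof (cases "z = 0")
      case True
      then show ?thesis
        using Schwarz_Lemma(2)[OF holw w0 w1 z(1)] z(2) h0 by simp
    next
      case False
      have "cmod z \<le> cmod (w z)"
        using z wh[OF z(1)] mult_left_mono[of 1 "cmod (h z)" "cmod z"] by (simp add: norm_mult)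
      then show ?thesis
        using Schwarz_Lemma(1)[OF holw w0 w1 z(1)] z(1) False by (intro disjI1 exI[of _ z]) simp
    qed
    then obtain \<alpha> where \<alpha>: "\<And>z. cmod z < 1 \<Longrightarrow> w z = \<alpha> * z" "cmod \<alpha> = 1"
      using Schwarz_Lemma(3)[OF holw w0 w1 z(1)] by blast
    have "(\<lambda>z. \<alpha> * z) has_fps_expansion fps_const \<alpha> * fps_X"
      by (rule has_fps_expansion_cmult_left[OF has_fps_expansion_fps_X])
    moreover have "\<forall>\<^sub>F z in nhds 0. w z = \<alpha> * z"
      by (rule eventually_nhds_in_open[THEN eventually_mono, of "ball 0 1"]) (use \<alpha> in auto)
    ultimately have "W = fps_const \<alpha> * fps_X"
      by (rule fps_eq_of_eventually_eq[OF W(1)])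
    then show ?thesis
      using \<alpha>(2) by simp
  qed
qed

lemma C_AP_inverse_log_coeffs:
  assumes f: "f \<in> C_AP" and w: "schwarz_function w"
    and ode: "\<And>z. z \<in> ball 0 1 \<Longrightarrow> z * deriv (deriv f) z = (psi_AP (w z) - 1) * deriv f z"
  defines "W \<equiv> fps_expansion w 0"
  shows "inverse_log_coeff f 1 = - (3/8) * fps_nth W 1"
    and "inverse_log_coeff f 2 = 31/192 * (fps_nth W 1)\<^sup>2 - fps_nth W 2 / 8"
proof -
  have f': "f holomorphic_on ball 0 1" "f 0 = 0" "deriv f 0 = 1"
    using f by (auto simp: C_AP_def normalized_analytic_def)
  have small: "\<exists>e>0. \<forall>z\<in>ball 0 1. cmod (f z) < e \<longrightarrow> cmod z < r" if "0 < r" "r < 1" for r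
    by (rule C_AP_small_values_near_0[OF f that]) blast
  have F2: "fps_nth (fps_expansion f 0) 2 = 3/4 * fps_nth W 1"
    unfolding W_def by (rule C_AP_coefficients(1)[OF f' w ode])
  have F3: "fps_nth (fps_expansion f 0) 3 = 1/4 * fps_nth W 2 + 25/48 * (fps_nth W 1)\<^sup>2"
    unfolding W_def by (rule C_AP_coefficients(2)[OF f' w ode])
  have "inverse_log_coeff f 1 = - fps_nth (fps_expansion f 0) 2 / 2"
    by (rule inverse_log_coeff_eq(1)[OF f' small])
  then show "inverse_log_coeff f 1 = - (3/8) * fps_nth W 1"
    unfolding F2 by simp
  have "inverse_log_coeff f 2 = - fps_nth (fps_expansion f 0) 3 / 2 + 3/4 * (fps_nth (fps_expansion f 0) 2)\<^sup>2"
    by (rule inverse_log_coeff_eq(2)[OF f' small])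
  then show "inverse_log_coeff f 2 = 31/192 * (fps_nth W 1)\<^sup>2 - fps_nth W 2 / 8"
    unfolding F2 F3 by (simp add: field_simps power2_eq_square)
qed

section \<open>Sharp bounds\<close>

text \<open>For the lower bound put \<open>b\<^sup>2 = 24/55\<close>. Up to \<open>|c| = b\<close> the trivial estimate \<open>|\<Gamma>\<^sub>2| \<ge> 0\<close> suffices.
  Beyond it the triangle inequality gives \<open>|\<Gamma>\<^sub>2| \<ge> 55/192 (|c|\<^sup>2 - b\<^sup>2)\<close>, which is at least
  \<open>3/8 (|c| - b)\<close> because \<open>|c| + b \<ge> 2 b \<ge> 72/55\<close>.\<close>
lemma coeff_difference_bounds:
  fixes c d :: complex
  assumes cd: "cmod d \<le> 1 - (cmod c)\<^sup>2"
  shows "cmod (31/192 * c\<^sup>2 - d / 8) - 3/8 * cmod c \<le> 1/8"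
    and "- (3/8 * sqrt (24/55)) \<le> cmod (31/192 * c\<^sup>2 - d / 8) - 3/8 * cmod c"
proof -
  define x where "x = cmod c"
  have x0: "0 \<le> x"
    by (simp add: x_def)
  have "x\<^sup>2 \<le> 1"
    using cd norm_ge_zero[of d] unfolding x_def by linarith
  then have x1: "x \<le> 1"
    using x0 by (simp add: power_le_one_iff)
  have d: "cmod (d / 8) \<le> (1 - x\<^sup>2) / 8"
    using cd by (simp add: norm_divide x_def)
  have c: "cmod (31/192 * c\<^sup>2) = 31/192 * x\<^sup>2"
    by (simp add: norm_mult norm_power x_def)
  have "cmod (31/192 * c\<^sup>2 - d / 8) \<le> 31/192 * x\<^sup>2 + (1 - x\<^sup>2) / 8"
    using norm_triangle_ineq4[of "31/192 * c\<^sup>2" "d / 8"] c d by linarith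
  moreover have "x\<^sup>2 \<le> x"
    using x0 x1 by (simp add: power2_eq_square mult_left_le)
  ultimately show "cmod (31/192 * c\<^sup>2 - d / 8) - 3/8 * cmod c \<le> 1/8"
    using x0 unfolding x_def[symmetric] by (simp add: field_simps)
  define b where "b = sqrt (24/55)"
  have b2: "b\<^sup>2 = 24/55"
    by (simp add: b_def)
  have b: "36/55 \<le> b"
    unfolding b_def by (rule real_le_rsqrt) (simp add: power2_eq_square)
  show "- (3/8 * sqrt (24/55)) \<le> cmod (31/192 * c\<^sup>2 - d / 8) - 3/8 * cmod c"
  proof (cases "x \<le> b")
    case True
    then show ?thesis
      using norm_ge_zero[of "31/192 * c\<^sup>2 - d / 8"] unfolding x_def[symmetric] b_def[symmetric]
      by linarith
  next
    case False
    have "3/8 * (x - b) = 55/192 * ((x - b) * (72/55))"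
      by simp
    also have "\<dots> \<le> 55/192 * ((x - b) * (x + b))"
      using False b by (intro mult_left_mono) auto
    also have "\<dots> = 55/192 * (x\<^sup>2 - b\<^sup>2)"
      by (simp add: power2_eq_square algebra_simps)
    also have "\<dots> = 31/192 * x\<^sup>2 - (1 - x\<^sup>2) / 8"
      unfolding b2 by (simp add: field_simps)
    also have "\<dots> \<le> cmod (31/192 * c\<^sup>2 - d / 8)"
      using norm_triangle_ineq2[of "31/192 * c\<^sup>2" "d / 8"] c d by linarith
    finally show ?thesis
      unfolding x_def[symmetric] b_def[symmetric] by simp
  qed
qed

lemma schwarz_function_square:
  "schwarz_function (\<lambda>z. z\<^sup>2)"
  "fps_nth (fps_expansion (\<lambda>z. z\<^sup>2) 0) 1 = 0" "fps_nth (fps_expansion (\<lambda>z. z\<^sup>2) 0) 2 = 1"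
proof -
  show "schwarz_function (\<lambda>z. z\<^sup>2)"
    by (auto simp: schwarz_function_def norm_power power_less_one_iff intro!: holomorphic_intros)
  have "fps_expansion (\<lambda>z. z\<^sup>2) 0 = fps_X\<^sup>2"
    by (rule fps_expansion_eqI[OF has_fps_expansion_fps_X_power])
  then show "fps_nth (fps_expansion (\<lambda>z. z\<^sup>2) 0) 1 = 0" "fps_nth (fps_expansion (\<lambda>z. z\<^sup>2) 0) 2 = 1"
    by simp_all
qed

text \<open>These functions attain equality in the Schwarz--Pick bound, with second coefficient
  positive, so that for \<open>c\<^sup>2 = 24/55\<close> the two terms of \<open>\<Gamma>\<^sub>2\<close> cancel.\<close>
lemma schwarz_function_Moebius:
  fixes c :: complex
  assumes c: "cmod c < 1"
  defines "w \<equiv> \<lambda>z. z * Moebius_function 0 (- c) z"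
  shows "schwarz_function w" "fps_nth (fps_expansion w 0) 1 = c"
    "fps_nth (fps_expansion w 0) 2 = 1 - (cmod c)\<^sup>2"
proof -
  have c': "cmod (- c) < 1"
    using c by simp
  show w: "schwarz_function w"
    unfolding schwarz_function_def
  proof (intro conjI ballI)
    show "w holomorphic_on ball 0 1"
      unfolding w_def by (intro holomorphic_intros Moebius_function_holomorphic[OF c'])
    show "cmod (w z) < 1" if "z \<in> ball 0 1" for z
      using norm_mult_less[of z 1 "Moebius_function 0 (- c) z" 1] Moebius_function_norm_lt_1[OF c', of z 0] that
      by (simp add: w_def)
  qed (simp add: w_def)
  define W where "W = fps_expansion w 0"
  note W = schwarz_function_expansion[OF w, folded W_def]
  have ev: "\<forall>\<^sub>F z in nhds 0. w z * (1 + cnj c * z) = z * (z + c)"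
  proof (rule eventually_nhds_in_open[THEN eventually_mono, of "ball 0 1"])
    fix z :: complex
    assume "z \<in> ball 0 1"
    then have "cmod (cnj c * z) < 1"
      using c norm_mult_less[of "cnj c" 1 z 1] by simp
    then have "1 + cnj c * z \<noteq> 0"
      by (metis add_eq_0_iff norm_minus_cancel norm_one less_irrefl)
    then show "w z * (1 + cnj c * z) = z * (z + c)"
      by (simp add: w_def Moebius_function_simple)
  qed auto
  have "(\<lambda>z. w z * (1 + cnj c * z)) has_fps_expansion W * (1 + fps_const (cnj c) * fps_X)"
    by (intro has_fps_expansion_mult[OF W(1)] has_fps_expansion_add has_fps_expansion_1
        has_fps_expansion_cmult_left has_fps_expansion_fps_X)
  moreover have "(\<lambda>z. z * (z + c)) has_fps_expansion fps_X * (fps_X + fps_const c)"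
    by (intro has_fps_expansion_mult has_fps_expansion_add has_fps_expansion_const has_fps_expansion_fps_X)
  ultimately have eq: "W * (1 + fps_const (cnj c) * fps_X) = fps_X * (fps_X + fps_const c)"
    using ev by (rule fps_eq_of_eventually_eq)
  show W1: "fps_nth W 1 = c"
    using arg_cong[OF eq, of "\<lambda>A. fps_nth A 1"] W(2) by (simp add: fps_mult_nth)
  have "fps_nth W 2 + cnj c * fps_nth W 1 = 1"
    using arg_cong[OF eq, of "\<lambda>A. fps_nth A 2"] W(2)
    by (simp add: fps_mult_nth numeral_2_eq_2 add.commute mult.commute)
  then show "fps_nth W 2 = 1 - (cmod c)\<^sup>2"
    unfolding W1 using complex_norm_square[of c] by (simp add: algebra_simps)
qed

theorem theorem4p1:
  shows "(\<forall>f\<in>C_AP.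
            - (3 * sqrt 6 / (4 * sqrt 55))
              \<le> cmod (inverse_log_coeff f 2) - cmod (inverse_log_coeff f 1) \<and>
            cmod (inverse_log_coeff f 2) - cmod (inverse_log_coeff f 1) \<le> 1 / 8) \<and>
         (\<exists>f\<in>C_AP. cmod (inverse_log_coeff f 2) - cmod (inverse_log_coeff f 1)
                     = - (3 * sqrt 6 / (4 * sqrt 55))) \<and>
         (\<exists>f\<in>C_AP. cmod (inverse_log_coeff f 2) - cmod (inverse_log_coeff f 1) = 1 / 8)"
proof -
  have sqrt24: "sqrt 24 = 2 * sqrt 6"
    by (rule real_sqrt_unique) (simp_all add: power_mult_distrib)
  have const: "3 * sqrt 6 / (4 * sqrt 55) = 3/8 * sqrt (24/55)"
    by (simp add: real_sqrt_divide sqrt24)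
  show ?thesis
    unfolding const
  proof (intro conjI ballI)
    fix f
    assume f: "f \<in> C_AP"
    obtain w where w: "schwarz_function w"
      and ode: "\<And>z. z \<in> ball 0 1 \<Longrightarrow> z * deriv (deriv f) z = (psi_AP (w z) - 1) * deriv f z"
      by (rule C_AP_imp_ode[OF f]) (rule that)
    have \<Gamma>: "inverse_log_coeff f 1 = - (3/8) * fps_nth (fps_expansion w 0) 1"
      "inverse_log_coeff f 2 = 31/192 * (fps_nth (fps_expansion w 0) 1)\<^sup>2
        - fps_nth (fps_expansion w 0) 2 / 8"
      by (rule C_AP_inverse_log_coeffs[OF f w ode], assumption?)+
    note bounds = coeff_difference_bounds[OF schwarz_function_coeff_bound[OF w]]
    show "- (3/8 * sqrt (24/55)) \<le> cmod (inverse_log_coeff f 2) - cmod (inverse_log_coeff f 1)"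
      "cmod (inverse_log_coeff f 2) - cmod (inverse_log_coeff f 1) \<le> 1 / 8"
      using bounds unfolding \<Gamma> by (simp_all add: norm_mult)
  next
    define c :: complex where "c = of_real (sqrt (24/55))"
    have c: "cmod c = sqrt (24/55)"
      by (simp add: c_def)
    have c2: "c\<^sup>2 = 24/55"
      unfolding c_def of_real_power[symmetric] by simp
    have c1: "cmod c < 1"
      unfolding c by (simp add: real_less_lsqrt)
    define w where "w = (\<lambda>z. z * Moebius_function 0 (- c) z)"
    note w = schwarz_function_Moebius[OF c1, folded w_def]
    obtain f where f: "f \<in> C_AP"
      and ode: "\<And>z. z \<in> ball 0 1 \<Longrightarrow> z * deriv (deriv f) z = (psi_AP (w z) - 1) * deriv f z"
      by (rule ode_solution_in_C_AP[OF w(1)]) (rule that)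
    have \<Gamma>: "inverse_log_coeff f 1 = - (3/8) * fps_nth (fps_expansion w 0) 1"
      "inverse_log_coeff f 2 = 31/192 * (fps_nth (fps_expansion w 0) 1)\<^sup>2
        - fps_nth (fps_expansion w 0) 2 / 8"
      by (rule C_AP_inverse_log_coeffs[OF f w(1) ode], assumption?)+
    have "cmod (inverse_log_coeff f 2) = 0"
      unfolding \<Gamma> w(2,3) c2 c by simp
    moreover have "cmod (inverse_log_coeff f 1) = 3/8 * sqrt (24/55)"
      unfolding \<Gamma> w(2,3) by (simp add: norm_mult c)
    ultimately show "\<exists>f\<in>C_AP. cmod (inverse_log_coeff f 2) - cmod (inverse_log_coeff f 1)
        = - (3/8 * sqrt (24/55))"
      using f by (intro bexI[of _ f]) simp_all
  next
    note w = schwarz_function_square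
    obtain f where f: "f \<in> C_AP"
      and ode: "\<And>z. z \<in> ball 0 1 \<Longrightarrow> z * deriv (deriv f) z = (psi_AP (z\<^sup>2) - 1) * deriv f z"
      by (rule ode_solution_in_C_AP[OF w(1)]) (rule that)
    have \<Gamma>: "inverse_log_coeff f 1 = - (3/8) * fps_nth (fps_expansion (\<lambda>z. z\<^sup>2) 0) 1"
      "inverse_log_coeff f 2 = 31/192 * (fps_nth (fps_expansion (\<lambda>z. z\<^sup>2) 0) 1)\<^sup>2
        - fps_nth (fps_expansion (\<lambda>z. z\<^sup>2) 0) 2 / 8"
      by (rule C_AP_inverse_log_coeffs[OF f w(1) ode], assumption?)+
    have "cmod (inverse_log_coeff f 2) - cmod (inverse_log_coeff f 1) = 1 / 8"
      unfolding \<Gamma> w(2,3) by simp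
    then show "\<exists>f\<in>C_AP. cmod (inverse_log_coeff f 2) - cmod (inverse_log_coeff f 1) = 1 / 8"
      using f by blast
  qed
qed

end
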